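(* Let $G$ be a finite non-abelian group of order $n$ and let $p$ be the smallest prime dividing $n$. Then the number of conjugacy classes of $G$ is at least $p|Z(G)|+1$. Hence the number of non-trivial conjugacy classes of $G$ is at least $(p-1)|Z(G)|+1$, and $(p-1)|Z(G)|+1\ge p$.
   Context: $Z(G)$ denotes the center of $G$. A conjugacy class is called non-trivial if it has more than one element (i.e. it is the class of an element outside $Z(G)$). *)

theory Defs
  imports "HOL-Algebra.Algebra"
begin

definition center :: "('a, 'b) monoid_scheme \<Rightarrow> 'a set"
  where "center G = {z \<in> carrier G. \<forall>g \<in> carrier G. z \<otimes>\<^bsub>G\<^esub> g = g \<otimes>\<^bsub>G\<^esub> z}"

text \<open>
  The orbits of the conjugation action of \<open>G\<close> on itself; this is a group action by
  \<open>group.action_by_conjugation\<close>.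
\<close>

definition conjugacy_classes :: "('a, 'b) monoid_scheme \<Rightarrow> 'a set set"
  where "conjugacy_classes G =
    orbits G (carrier G) (\<lambda>g. \<lambda>h \<in> carrier G. g \<otimes>\<^bsub>G\<^esub> h \<otimes>\<^bsub>G\<^esub> inv\<^bsub>G\<^esub> g)"

definition nontrivial_conjugacy_classes :: "('a, 'b) monoid_scheme \<Rightarrow> 'a set set"
  where "nontrivial_conjugacy_classes G = {C \<in> conjugacy_classes G. 1 < card C}"

end

theory Submission
  imports Defs
begin

text \<open>
  Write \<open>z\<close> for the order of the center and \<open>n\<close> for the order of the group. The centralizer of a
  non-central element \<open>x\<close> lies strictly between the center and the group: it contains \<open>x\<close>, which
  the center does not, and it is not everything because \<open>x\<close> is not central. Each proper inclusion
  of subgroups multiplies the order by a non-trivial divisor of \<open>n\<close>, hence by at least the smallest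
  prime \<open>p\<close> (\<open>smallest_prime_mult_card_le\<close>). So the centralizer has at least \<open>p z\<close> elements, and by
  the orbit-stabilizer theorem every non-trivial class has at most \<open>n / (p z)\<close> elements
  (\<open>card_nontrivial_class_le\<close>).

  The \<open>n - z\<close> non-central elements are covered by the \<open>t\<close> non-trivial classes, so
  \<open>p z (n - z) \<le> t n\<close>. Since the centralizer above is a proper subgroup, \<open>p z < n\<close>, and therefore
  \<open>t n \<ge> p z n - (p z) z > (p - 1) z n\<close>, that is \<open>t > (p - 1) z\<close>. The trivial classes are the
  singletons of central elements, which adds \<open>z\<close> to the count.
\<close>

abbreviation conjugation :: "('a, 'b) monoid_scheme \<Rightarrow> 'a \<Rightarrow> 'a \<Rightarrow> 'a"
  where "conjugation G \<equiv> (\<lambda>g. \<lambda>h \<in> carrier G. g \<otimes>\<^bsub>G\<^esub> h \<otimes>\<^bsub>G\<^esub> inv\<^bsub>G\<^esub> g)"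

lemma (in group) stabilizer_conjugation:
  assumes "x \<in> carrier G"
  shows "stabilizer G (conjugation G) x = {g \<in> carrier G. g \<otimes> x = x \<otimes> g}"
  using assms by (auto simp: stabilizer_def inv_solve_right')

text \<open>
  Stabilizers are subgroups, so this form of the center makes it a subgroup without a separate
  closure argument.
\<close>

lemma (in group) center_eq_Inter_stabilizers:
  "center G = (\<Inter>x\<in>carrier G. stabilizer G (conjugation G) x)"
  using one_closed by (auto simp: center_def stabilizer_conjugation)

lemma (in group) subgroup_center: "subgroup (center G) G"
  unfolding center_eq_Inter_stabilizers
  by (rule subgroups_Inter)
    (use one_closed in \<open>auto intro: group_action.stabilizer_subgroup[OF action_by_conjugation]\<close>)

text \<open>
  The index of a proper inclusion of subgroups is a divisor of the group order other than 1, so it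
  has a prime factor, and this is at least the smallest prime dividing the group order.
\<close>

lemma (in group) smallest_prime_mult_card_le:
  fixes p :: nat
  assumes fin: "finite (carrier G)"
    and H: "subgroup H G" and K: "subgroup K G" and "H \<subset> K"
    and least: "\<And>q :: nat. Factorial_Ring.prime q \<Longrightarrow> q dvd order G \<Longrightarrow> p \<le> q"
  shows "p * card H \<le> card K"
proof -
  interpret K: group "G\<lparr>carrier := K\<rparr>"
    using K by (rule subgroup_imp_group)
  have "subgroup H (G\<lparr>carrier := K\<rparr>)"
    using subgroup_incl[OF H K] \<open>H \<subset> K\<close> by blast
  then obtain i where i: "card K = i * card H"
    using K.lagrange[of H] by (simp add: order_def) metis
  have finK: "finite K"
    using fin subgroup.subset[OF K] finite_subset by blast
  have "card H < card K"
    using \<open>H \<subset> K\<close> finK by (rule psubset_card_mono[rotated])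
  then have "i \<noteq> 1" "i \<noteq> 0" using i by auto
  then obtain q where q: "Factorial_Ring.prime q" "q dvd i"
    using prime_factor_nat by blast
  have "card K dvd order G"
    using lagrange[OF K] by (metis dvd_triv_right)
  then have "p \<le> q"
    using least[OF q(1)] q(2) i by (metis dvd_mult2 dvd_trans)
  also have "q \<le> i"
    using q(2) \<open>i \<noteq> 0\<close> by (simp add: dvd_imp_le)
  finally show ?thesis
    unfolding i by simp
qed

lemma (in group) center_psubset_centralizer:
  assumes "x \<in> carrier G" "x \<notin> center G"
  shows "center G \<subset> stabilizer G (conjugation G) x"
  using assms by (auto simp: center_def stabilizer_conjugation)

lemma (in group) centralizer_psubset_carrier:
  assumes "x \<in> carrier G" "x \<notin> center G"
  shows "stabilizer G (conjugation G) x \<subset> carrier G"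
  using assms unfolding center_def stabilizer_conjugation[OF assms(1)] by force

text \<open>
  A class contains its representative, and it contains nothing else exactly when every group
  element fixes the representative under conjugation.
\<close>

lemma (in group) class_singleton_iff_center:
  assumes "x \<in> carrier G"
  shows "orbit G (conjugation G) x = {x} \<longleftrightarrow> x \<in> center G"
proof -
  have "x \<in> orbit G (conjugation G) x"
    using assms by (rule group_action.orbit_refl[OF action_by_conjugation])
  then have "orbit G (conjugation G) x = {x} \<longleftrightarrow> (\<forall>g\<in>carrier G. g \<otimes> x \<otimes> inv g = x)"
    using assms by (auto simp: orbit_def)
  also have "\<dots> \<longleftrightarrow> x \<in> center G"
    using assms by (auto simp: center_def inv_solve_right')
  finally show ?thesis .
qed

lemma (in group) card_class_gt_1_iff:
  assumes "finite (carrier G)" "x \<in> carrier G"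
  shows "1 < card (orbit G (conjugation G) x) \<longleftrightarrow> x \<notin> center G"
proof -
  let ?C = "orbit G (conjugation G) x"
  have x: "x \<in> ?C"
    using assms(2) by (rule group_action.orbit_refl[OF action_by_conjugation])
  have "finite ?C"
    using assms(1) by (simp add: orbit_def)
  then have "card ?C \<noteq> 0"
    using x by auto
  moreover have "card ?C = 1 \<longleftrightarrow> ?C = {x}"
    using x by (auto simp: card_1_singleton_iff)
  ultimately show ?thesis
    using class_singleton_iff_center[OF assms(2)] by linarith
qed

lemma (in group) nontrivial_conjugacy_classes_eq:
  assumes "finite (carrier G)"
  shows "nontrivial_conjugacy_classes G =
    orbit G (conjugation G) ` (carrier G - center G)"
  using card_class_gt_1_iff[OF assms]
  by (auto simp: nontrivial_conjugacy_classes_def conjugacy_classes_def orbits_def)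

lemma (in group) conjugacy_classes_eq:
  assumes "finite (carrier G)"
  shows "conjugacy_classes G = (\<lambda>z. {z}) ` center G \<union> nontrivial_conjugacy_classes G"
proof -
  have "center G \<subseteq> carrier G"
    by (auto simp: center_def)
  then have "conjugacy_classes G = orbit G (conjugation G) ` center G
      \<union> orbit G (conjugation G) ` (carrier G - center G)"
    by (auto simp: conjugacy_classes_def orbits_def)
  also have "orbit G (conjugation G) ` center G = (\<lambda>z. {z}) ` center G"
    using class_singleton_iff_center \<open>center G \<subseteq> carrier G\<close> by (intro image_cong) auto
  finally show ?thesis
    unfolding nontrivial_conjugacy_classes_eq[OF assms] .
qed

lemma (in group) card_conjugacy_classes:
  assumes "finite (carrier G)"
  shows "card (conjugacy_classes G) = card (center G) + card (nontrivial_conjugacy_classes G)"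
proof -
  have "finite (center G)"
    using assms by (auto simp: center_def)
  moreover have "finite (nontrivial_conjugacy_classes G)"
    using assms by (simp add: nontrivial_conjugacy_classes_eq)
  moreover have "(\<lambda>z. {z}) ` center G \<inter> nontrivial_conjugacy_classes G = {}"
    by (auto simp: nontrivial_conjugacy_classes_def)
  ultimately show ?thesis
    by (simp add: conjugacy_classes_eq[OF assms] card_Un_disjoint card_image)
qed

lemma (in group) Union_nontrivial_conjugacy_classes:
  assumes "finite (carrier G)"
  shows "carrier G - center G \<subseteq> \<Union> (nontrivial_conjugacy_classes G)"
  using group_action.orbit_refl[OF action_by_conjugation]
  by (auto simp: nontrivial_conjugacy_classes_eq[OF assms])

text \<open>
  By the orbit-stabilizer theorem the size of a class is the index of a centralizer, and the
  centralizer of a non-central element is at least \<open>p\<close> times as large as the center.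
\<close>

lemma (in group) card_nontrivial_class_le:
  fixes p :: nat
  assumes fin: "finite (carrier G)"
    and least: "\<And>q :: nat. Factorial_Ring.prime q \<Longrightarrow> q dvd order G \<Longrightarrow> p \<le> q"
    and C: "C \<in> nontrivial_conjugacy_classes G"
  shows "p * card (center G) * card C \<le> order G"
proof -
  obtain x where x: "x \<in> carrier G" "x \<notin> center G" and C: "C = orbit G (conjugation G) x"
    using C fin by (auto simp: nontrivial_conjugacy_classes_eq)
  let ?S = "stabilizer G (conjugation G) x"
  have "p * card (center G) \<le> card ?S"
    using fin subgroup_center
      group_action.stabilizer_subgroup[OF action_by_conjugation x(1)]
      center_psubset_centralizer[OF x] least
    by (rule smallest_prime_mult_card_le)
  then have "p * card (center G) * card C \<le> card C * card ?S"
    unfolding mult.commute[of "card C"] by (rule mult_le_mono1)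
  also have "\<dots> = order G"
    unfolding C by (rule group_action.orbit_stabilizer_theorem[OF action_by_conjugation x(1)])
  finally show ?thesis .
qed

text \<open>
  The inequality is strict because of the second proper inclusion in the chain center, centralizer,
  group. Strictness here is what turns the bound \<open>(p - 1) z\<close> on the number of non-trivial classes
  into \<open>(p - 1) z + 1\<close>.
\<close>

lemma (in group) smallest_prime_mult_card_center_less:
  fixes p :: nat
  assumes fin: "finite (carrier G)"
    and least: "\<And>q :: nat. Factorial_Ring.prime q \<Longrightarrow> q dvd order G \<Longrightarrow> p \<le> q"
    and nonab: "\<not> comm_group G"
  shows "p * card (center G) < order G"
proof -
  obtain x where x: "x \<in> carrier G" "x \<notin> center G"
    using nonab group_comm_groupI by (auto simp: center_def)
  let ?S = "stabilizer G (conjugation G) x"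
  have "p * card (center G) \<le> card ?S"
    using fin subgroup_center
      group_action.stabilizer_subgroup[OF action_by_conjugation x(1)]
      center_psubset_centralizer[OF x] least
    by (rule smallest_prime_mult_card_le)
  also have "\<dots> < order G"
    unfolding order_def using fin centralizer_psubset_carrier[OF x] by (rule psubset_card_mono)
  finally show ?thesis .
qed

text \<open>
  The non-trivial classes cover the complement of the center, and each of them is small, so there
  must be many of them.
\<close>

lemma (in group) card_nontrivial_conjugacy_classes_greater:
  fixes p :: nat
  assumes fin: "finite (carrier G)"
    and least: "\<And>q :: nat. Factorial_Ring.prime q \<Longrightarrow> q dvd order G \<Longrightarrow> p \<le> q"
    and nonab: "\<not> comm_group G"
    and "0 < p"
  shows "(p - 1) * card (center G) < card (nontrivial_conjugacy_classes G)"
proof -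
  define z where "z = card (center G)"
  define t where "t = card (nontrivial_conjugacy_classes G)"
  have z_pos: "0 < z"
    unfolding z_def using subgroup.finite_imp_card_positive[OF subgroup_center fin] .
  have pz_less: "p * z < order G"
    unfolding z_def using fin least nonab by (rule smallest_prime_mult_card_center_less)
  have "finite (nontrivial_conjugacy_classes G)"
    using fin by (simp add: nontrivial_conjugacy_classes_eq)
  moreover have "finite C" if "C \<in> nontrivial_conjugacy_classes G" for C
    using that fin by (auto simp: nontrivial_conjugacy_classes_def intro: card_ge_0_finite)
  ultimately have fin_Union: "finite (\<Union> (nontrivial_conjugacy_classes G))"
    by (rule finite_Union)
  have "order G - z = card (carrier G - center G)"
    unfolding z_def order_def using fin subgroup.subset[OF subgroup_center]
    by (metis card_Diff_subset finite_subset)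
  also have "\<dots> \<le> card (\<Union> (nontrivial_conjugacy_classes G))"
    by (rule card_mono[OF fin_Union Union_nontrivial_conjugacy_classes[OF fin]])
  also have "\<dots> \<le> (\<Sum>C\<in>nontrivial_conjugacy_classes G. card C)"
    by (rule card_Union_le_sum_card_weak)
      (use fin_Union in \<open>meson Union_upper finite_subset\<close>)
  finally have "p * z * (order G - z) \<le> p * z * (\<Sum>C\<in>nontrivial_conjugacy_classes G. card C)"
    by (rule mult_le_mono2)
  also have "\<dots> = (\<Sum>C\<in>nontrivial_conjugacy_classes G. p * z * card C)"
    by (rule sum_distrib_left)
  also have "\<dots> \<le> t * order G"
    unfolding t_def z_def
    using sum_bounded_above[OF card_nontrivial_class_le[OF fin least]] by simp
  finally have count: "p * z * order G - p * z * z \<le> t * order G"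
    by (simp add: diff_mult_distrib2)
  have "p * z * z < z * order G"
    using pz_less z_pos by (simp add: mult.commute)
  \<comment> \<open>The subtraction in \<open>count\<close> is truncated, but \<open>a - b \<le> c\<close> still gives \<open>a \<le> b + c\<close>.\<close>
  then have "p * z * order G < (t + z) * order G"
    using count unfolding distrib_right by linarith
  then have "p * z < t + z"
    by simp
  then show ?thesis
    using \<open>0 < p\<close> unfolding z_def t_def by (simp add: diff_mult_distrib less_diff_conv2)
qed

theorem corollary19p1:
  fixes G :: "('a, 'b) monoid_scheme" and n p :: nat
  assumes "group G"
    and "finite (carrier G)"
    and "\<not> comm_group G"
    and "order G = n"
    and "Factorial_Ring.prime p"
    and "p dvd n"
    and "\<And>q :: nat. Factorial_Ring.prime q \<Longrightarrow> q dvd n \<Longrightarrow> p \<le> q"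
  shows "card (conjugacy_classes G) \<ge> p * card (center G) + 1
    \<and> card (nontrivial_conjugacy_classes G) \<ge> (p - 1) * card (center G) + 1
    \<and> (p - 1) * card (center G) + 1 \<ge> p"
proof -
  interpret group G by fact
  have "0 < p"
    using \<open>Factorial_Ring.prime p\<close> by (rule prime_gt_0_nat)
  have many: "(p - 1) * card (center G) + 1 \<le> card (nontrivial_conjugacy_classes G)"
    using card_nontrivial_conjugacy_classes_greater[OF assms(2) _ assms(3) \<open>0 < p\<close>] assms(4,7)
    by (simp add: Suc_le_eq)
  from \<open>0 < p\<close> have "p * card (center G) = card (center G) + (p - 1) * card (center G)"
    by (metis Suc_diff_1 mult_Suc)
  with many have "p * card (center G) + 1 \<le> card (conjugacy_classes G)"
    by (simp add: card_conjugacy_classes[OF assms(2)])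
  moreover have "p \<le> (p - 1) * card (center G) + 1"
  proof -
    have "0 < card (center G)"
      using subgroup.finite_imp_card_positive[OF subgroup_center assms(2)] .
    then have "p - 1 \<le> (p - 1) * card (center G)"
      by simp
    then show ?thesis
      by linarith
  qed
  ultimately show ?thesis
    using many by blast
qed

end
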